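(* Let $(\mathbf{Z}_n)_{n\ge 0}$, $(\mathbf{I}_n)_{n\ge 1}$ and $\mathbf{F}$ be as in the context, with a general strictly increasing $f\in\mathcal{C}^1([0,1])$ with values in $[0,1]$. The zero set $\mathcal{Z}(\mathbf{F})=\{\mathbf{z}\in[0,1]^N:\mathbf{F}(\mathbf{z})=\mathbf{0}\}$ contains at least one point of the form $z\mathbf{1}$ with $z\in[0,1]$. Moreover, if $\mathcal{Z}(\mathbf{F})$ is finite and $f$ admits a primitive function, then there is a random variable $\mathbf{Z}_\infty$ with values in $\mathcal{Z}(\mathbf{F})$ such that $$\mathbf{Z}_n\longrightarrow \mathbf{Z}_\infty\quad\text{almost surely, and}\quad \frac1n\sum_{k=1}^n\mathbf{I}_k\longrightarrow \mathbf{Z}_\infty\quad\text{almost surely.}$$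
   Context: Model. Let $N\ge 2$, $\alpha,\beta\in[0,1)$ with $\alpha+\beta\in(0,1)$, $q\in(0,1]$, and let $f:[0,1]\to[0,1]$ be strictly increasing and of class $\mathcal{C}^1([0,1])$. Let $(r_n)_{n\ge0}$ be a deterministic sequence in $[0,1]$ with $\lim_{n\to\infty} n r_n=1$. Let $Z_{0,h}$, $1\le h\le N$, be random variables with values in $[0,1]$. For $n\ge 0$ and $1\le h\le N$ set $Z_{n+1,h}=(1-r_n)Z_{n,h}+r_nI_{n+1,h}$, where the $I_{n+1,h}$ take values in $\{0,1\}$ and, given $\mathcal{F}_n=\sigma(Z_{0,h}:1\le h\le N)\vee\sigma(I_{k,h}:1\le k\le n,\,1\le h\le N)$, the variables $I_{n+1,1},\dots,I_{n+1,N}$ are conditionally independent with $$P(I_{n+1,h}=1\mid\mathcal{F}_n)=\alpha Z_n+\beta q+(1-\alpha-\beta)f(Z_{n,h}),\qquad Z_n=\frac1N\sum_{i=1}^N Z_{n,i}.$$ Write $\mathbf{Z}_n=(Z_{n,1},\dots,Z_{n,N})^\top$, $\mathbf{I}_n=(I_{n,1},\dots,I_{n,N})^\top$, and let $\mathbf{0}$, $\mathbf{1}$ be the vectors with all components equal to $0$, respectively $1$. Define $\mathbf{F}=(F_1,\dots,F_N)^\top$ on $[0,1]^N$ by $$F_h(\mathbf{z})=\alpha\frac1N\sum_{i=1}^Nz_i+\beta q+(1-\alpha-\beta)f(z_h)-z_h .$$ *)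

theory Defs
  imports "HOL-Probability.Probability"
begin

text \<open>A version of the conditional probability of the event \<open>A\<close> given the sub-sigma-algebra \<open>G\<close> of \<open>M\<close>.\<close>

definition cond_prob_alg :: "'a measure \<Rightarrow> 'a measure \<Rightarrow> 'a set \<Rightarrow> 'a \<Rightarrow> real" where
  "cond_prob_alg M G A = real_cond_exp M G (indicator A)"

text \<open>Conditional independence given \<open>G\<close>: for every finite nonempty subfamily the joint conditional
  probability almost surely factorises.\<close>

definition cond_indep_vars ::
  "'a measure \<Rightarrow> 'a measure \<Rightarrow> ('i \<Rightarrow> 'b measure) \<Rightarrow> ('i \<Rightarrow> 'a \<Rightarrow> 'b) \<Rightarrow> 'i set \<Rightarrow> bool" where
  "cond_indep_vars M G M' X I \<longleftrightarrow>
     (\<forall>i\<in>I. X i \<in> measurable M (M' i)) \<and>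
     (\<forall>J\<subseteq>I. J \<noteq> {} \<longrightarrow> finite J \<longrightarrow> (\<forall>A. (\<forall>j\<in>J. A j \<in> sets (M' j)) \<longrightarrow>
        (AE \<omega> in M. cond_prob_alg M G (\<Inter>j\<in>J. X j -` A j \<inter> space M) \<omega>
                   = (\<Prod>j\<in>J. cond_prob_alg M G (X j -` A j \<inter> space M) \<omega>))))"

text \<open>The sigma-algebra generated by the components of \<open>Z 0\<close> and of \<open>I 1, \<dots>, I n\<close>.
  The index type \<open>'n\<close> plays the role of \<open>{1..N}\<close>; the value \<open>I 0\<close> is never used.\<close>

definition hist_alg ::
  "'a measure \<Rightarrow> (nat \<Rightarrow> 'a \<Rightarrow> real^'n) \<Rightarrow> (nat \<Rightarrow> 'a \<Rightarrow> real^'n) \<Rightarrow> nat \<Rightarrow> 'a measure" where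
  "hist_alg M Z I n = sigma (space M)
     ({(\<lambda>\<omega>. Z 0 \<omega> $ h) -` A \<inter> space M | h A. A \<in> sets borel} \<union>
      {(\<lambda>\<omega>. I k \<omega> $ h) -` A \<inter> space M | k h A. k \<in> {1..n} \<and> A \<in> sets borel})"

definition vec_mean :: "real^'n \<Rightarrow> real" where
  "vec_mean z = (1 / real CARD('n)) * (\<Sum>i\<in>UNIV. z $ i)"

definition drift :: "real \<Rightarrow> real \<Rightarrow> real \<Rightarrow> (real \<Rightarrow> real) \<Rightarrow> real^'n \<Rightarrow> real^'n" where
  "drift \<alpha> \<beta> q f z =
     (\<chi> h. \<alpha> * vec_mean z + \<beta> * q + (1 - \<alpha> - \<beta>) * f (z $ h) - z $ h)"

text \<open>The drift is meant on the unit cube only, so its zeros outside the cube are discarded.\<close>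

definition drift_zeros :: "real \<Rightarrow> real \<Rightarrow> real \<Rightarrow> (real \<Rightarrow> real) \<Rightarrow> (real^'n) set" where
  "drift_zeros \<alpha> \<beta> q f = {z. (\<forall>h. z $ h \<in> {0..1}) \<and> drift \<alpha> \<beta> q f z = 0}"

end

theory Submission
  imports Defs
begin

text \<open>Each step is \<open>Z (n + 1) = Z n + r n *\<^sub>R (F (Z n) + noise n)\<close> with bounded martingale
  differences \<open>noise n\<close>. As \<open>F\<close> is the gradient of a potential \<open>V\<close>, an increment of \<open>V (Z n)\<close> is at
  least \<open>r n * norm (F (Z n)) ^ 2\<close> plus a martingale difference, up to \<open>O (r n ^ 2)\<close>; since \<open>V\<close> is bounded
  on the cube, the series of \<open>r n * norm (F (Z n)) ^ 2\<close> converges almost surely. The series of \<open>r n\<close>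
  diverges, and an excursion of \<open>F (Z n)\<close> away from zero needs a fixed displacement, which the tails of
  these series do not allow; so \<open>F (Z n)\<close> tends to zero. The steps of \<open>Z\<close> tend to zero too, hence \<open>Z\<close>
  cannot jump between the finitely many zeros and converges to one of them. The averages of \<open>I\<close> follow
  by Cesaro means for \<open>Z n + F (Z n)\<close> and Kronecker's lemma for the noise.\<close>

subsection \<open>Deterministic recursions\<close>

lemma cesaro_means:
  fixes x :: "nat \<Rightarrow> 'a::real_normed_vector"
  assumes "x \<longlonglongrightarrow> l"
  shows "(\<lambda>n. (1 / real n) *\<^sub>R (\<Sum>k<n. x k)) \<longlonglongrightarrow> l"
proof (rule metric_LIMSEQ_I)
  fix e :: real assume e: "e > 0"
  obtain N where N: "\<And>n. n \<ge> N \<Longrightarrow> norm (x n - l) < e / 2"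
    using LIMSEQ_D[OF assms, of "e / 2"] e by auto
  define C where "C = (\<Sum>k<N. norm (x k - l))"
  have C: "C \<ge> 0" unfolding C_def by (intro sum_nonneg) auto
  \<comment> \<open>Beyond \<open>m\<close>, the fixed head \<open>C\<close> contributes less than
    \<open>e / 2\<close> after division by \<open>n\<close>.\<close>
  obtain m where m: "2 * C / e < real m" using reals_Archimedean2 by blast
  show "\<exists>n0. \<forall>n\<ge>n0. dist ((1 / real n) *\<^sub>R (\<Sum>k<n. x k)) l < e"
  proof (intro exI[of _ "max (Suc N) m"] allI impI)
    fix n assume "n \<ge> max (Suc N) m"
    then have n: "n > N" "n \<ge> m" by auto
    have "(\<Sum>k<n. norm (x k - l)) = C + (\<Sum>k=N..<n. norm (x k - l))"
      unfolding C_def lessThan_atLeast0 using n by (simp add: sum.atLeastLessThan_concat)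
    also have "(\<Sum>k=N..<n. norm (x k - l)) \<le> (\<Sum>k=N..<n. e / 2)"
      by (intro sum_mono) (use N less_imp_le in auto)
    also have "\<dots> \<le> real n * (e / 2)" using e n by simp
    also have "C < real n * (e / 2)"
    proof -
      have "C < real m * (e / 2)" using m e by (simp add: field_simps)
      also have "\<dots> \<le> real n * (e / 2)" using e n by (intro mult_right_mono) auto
      finally show ?thesis .
    qed
    finally have S: "(\<Sum>k<n. norm (x k - l)) < real n * e" by (simp add: mult.commute)
    have "(1 / real n) *\<^sub>R (\<Sum>k<n. x k) - l = (1 / real n) *\<^sub>R (\<Sum>k<n. x k - l)"
      using n by (simp add: sum_subtractf scaleR_diff_right flip: scaleR_left.sum)
        (simp add: sum_constant_scaleR)
    then have "dist ((1 / real n) *\<^sub>R (\<Sum>k<n. x k)) l \<le> (1 / real n) * (\<Sum>k<n. norm (x k - l))"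
      by (simp add: dist_norm divide_right_mono norm_sum)
    also have "\<dots> < e" using S n by (simp add: field_simps)
    finally show "dist ((1 / real n) *\<^sub>R (\<Sum>k<n. x k)) l < e" .
  qed
qed

text \<open>Summation by parts: with \<open>S\<close> the partial sums of the weighted series, the
  average of \<open>x\<close> equals \<open>S n\<close> minus the Cesaro mean of \<open>S\<close>,
  and both tend to the same limit.\<close>

lemma kronecker_means:
  fixes x :: "nat \<Rightarrow> real"
  assumes "summable (\<lambda>n. x n / (real n + 1))"
  shows "(\<lambda>n. (\<Sum>k<n. x k) / real n) \<longlonglongrightarrow> 0"
proof -
  define S where "S n = (\<Sum>k<n. x k / (real k + 1))" for n
  obtain s where s: "S \<longlonglongrightarrow> s"
    using assms unfolding S_def summable_def sums_def by blast
  have eq: "(\<Sum>k<n. x k) = real n * S n - (\<Sum>k<n. S k)" for n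
  proof (induction n)
    case (Suc n)
    have "real (Suc n) * (x n / (real n + 1)) = x n" by (simp add: add.commute)
    moreover have "S (Suc n) = S n + x n / (real n + 1)" by (simp add: S_def)
    ultimately have "real (Suc n) * S (Suc n) = real (Suc n) * S n + x n" by (simp only: distrib_left)
    then show ?case using Suc by (simp add: algebra_simps)
  qed simp
  have "(\<lambda>n. S n - (1 / real n) *\<^sub>R (\<Sum>k<n. S k)) \<longlonglongrightarrow> s - s"
    by (intro tendsto_diff s cesaro_means)
  moreover have "eventually (\<lambda>n. S n - (1 / real n) *\<^sub>R (\<Sum>k<n. S k) = (\<Sum>k<n. x k) / real n) sequentially"
    using eventually_gt_at_top[of 0] by eventually_elim (simp add: eq field_simps)
  ultimately show ?thesis by (simp add: tendsto_cong)
qed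

section \<open>Recursions driven by a vector field on a compact set\<close>

text \<open>By compactness \<open>z n\<close> is eventually close to some zero of \<open>F\<close>.
  Finitely many zeros are uniformly separated, so steps that are short compared with the separation
  cannot lead from one zero to another.\<close>

lemma converges_to_zero_of_finite_zeros:
  fixes F :: "'a::heine_borel \<Rightarrow> 'b::real_normed_vector"
  assumes K: "compact K" and F: "continuous_on K F"
    and z: "\<And>n. z n \<in> K"
    and Fz: "(\<lambda>n. F (z n)) \<longlonglongrightarrow> 0"
    and step: "(\<lambda>n. dist (z (Suc n)) (z n)) \<longlonglongrightarrow> 0"
    and fin: "finite {x \<in> K. F x = 0}"
  shows "\<exists>p\<in>K. F p = 0 \<and> z \<longlonglongrightarrow> p"
proof -
  define P where "P = {x \<in> K. F x = 0}"
  have near: "eventually (\<lambda>n. \<exists>p\<in>P. dist p (z n) < e) sequentially" if e: "e > 0" for e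
  proof -
    \<comment> \<open>Away from the zeros \<open>norm (F x)\<close> has a positive minimum on this
      compact set, while \<open>F (z n)\<close> tends to zero; so \<open>z\<close> eventually leaves
      the set for good.\<close>
    define C where "C = K - (\<Union>p\<in>P. ball p e)"
    have C: "compact C" unfolding C_def by (intro compact_diff K open_UN) auto
    have in_C: "\<exists>p\<in>P. dist p (z n) < e" if "z n \<notin> C" for n
      using that z[of n] by (auto simp: C_def)
    show ?thesis
    proof (cases "C = {}")
      case True then show ?thesis using in_C by auto
    next
      case False
      have "continuous_on C (\<lambda>x. norm (F x))"
        by (intro continuous_on_norm continuous_on_subset[OF F]) (auto simp: C_def)
      from continuous_attains_inf[OF C False this]
      obtain c where c: "c \<in> C" "\<And>y. y \<in> C \<Longrightarrow> norm (F c) \<le> norm (F y)" by blast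
      have "c \<notin> P" using c(1) e by (force simp: C_def)
      then have "norm (F c) > 0" using c(1) by (auto simp: C_def P_def)
      from order_tendstoD(2)[OF tendsto_norm_zero[OF Fz] this]
      show ?thesis by eventually_elim (use in_C c(2) in force)
    qed
  qed
  obtain d where d: "d > 0" "\<And>x y. x \<in> P \<Longrightarrow> y \<in> P \<Longrightarrow> dist x y < d \<Longrightarrow> x = y"
    using uniform_discrete_finite_iff[of P] fin
    unfolding P_def[symmetric] uniform_discrete_def by metis
  \<comment> \<open>With \<open>d / 4\<close>, the three distances between the zeros near
    \<open>z n\<close> and near \<open>z (Suc n)\<close> add up to less than the separation
    \<open>d\<close>.\<close>
  from eventually_conj[OF near[of "d/4"] order_tendstoD(2)[OF step, of "d/4"]] d(1)
  obtain N where N: "\<And>n. n \<ge> N \<Longrightarrow> \<exists>p\<in>P. dist p (z n) < d/4"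
      "\<And>n. n \<ge> N \<Longrightarrow> dist (z (Suc n)) (z n) < d/4"
    unfolding eventually_sequentially by auto
  obtain p where p: "p \<in> P" "dist p (z N) < d/4" using N(1) by blast
  have stay: "dist p (z n) < d/4" if "n \<ge> N" for n
    using that
  proof (induction n rule: dec_induct)
    case base show ?case by (rule p)
  next
    case (step n)
    obtain p' where p': "p' \<in> P" "dist p' (z (Suc n)) < d/4" using N(1)[of "Suc n"] step by auto
    have "dist p p' \<le> dist p (z n) + dist (z (Suc n)) (z n) + dist p' (z (Suc n))"
      by metric
    also have "\<dots> < d" using step.IH p'(2) N(2)[OF step(1)] d(1) by linarith
    finally show ?case using d(2) p p' by metis
  qed
  have "z \<longlonglongrightarrow> p"
  proof (rule tendstoI)
    fix e :: real assume e: "e > 0"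
    \<comment> \<open>The bound \<open>d / 4\<close> identifies the nearby zero as \<open>p\<close>;
      the bound \<open>e\<close> then gives the required estimate.\<close>
    have "min e (d/4) > 0" using e d by auto
    from near[OF this] eventually_ge_at_top[of N]
    show "eventually (\<lambda>n. dist (z n) p < e) sequentially"
    proof eventually_elim
      fix n assume a: "\<exists>p\<in>P. dist p (z n) < min e (d/4)" "N \<le> n"
      then obtain p' where p': "p' \<in> P" "dist p' (z n) < min e (d/4)" by blast
      have "dist p p' \<le> dist p (z n) + dist p' (z n)" by metric
      also have "\<dots> < d" using stay[OF a(2)] p'(2) d(1) by linarith
      finally have "p = p'" using d(2) p p' by blast
      then show "dist (z n) p < e" using p'(2) by (simp add: dist_commute)
    qed
  qed
  then show ?thesis using p(1) by (auto simp: P_def)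
qed

text \<open>If \<open>v\<close> stayed at or above \<open>e\<close> from \<open>N\<close> on, the
  convergent weighted series would dominate \<open>e\<close> times the divergent series of
  \<open>r\<close>.\<close>

lemma not_summable_frequently_small:
  fixes r v :: "nat \<Rightarrow> real"
  assumes r: "\<And>n. r n \<ge> 0" and div: "\<not> summable r"
    and sum: "summable (\<lambda>n. r n * v n)" and e: "e > 0"
  shows "\<exists>m\<ge>N. v m < e"
proof (rule ccontr)
  assume "\<not> ?thesis"
  then have v: "v m \<ge> e" if "m \<ge> N" for m using that by force
  have "summable (\<lambda>n. r n * e)"
  proof (rule summable_comparison_test'[OF sum, of N])
    fix n assume "n \<ge> N"
    then show "norm (r n * e) \<le> r n * v n" using r e v by (simp add: mult_left_mono)
  qed
  then have "summable (\<lambda>n. r n * e / e)" by (rule summable_divide)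
  then show False using div e by simp
qed

text \<open>By uniform continuity \<open>F\<close> can change by \<open>a\<close> only over a
  displacement of at least \<open>d\<close>. While \<open>norm (F (z k))\<close> is at least
  \<open>a\<close>, the drift displacement is at most the tail of the squared series divided by
  \<open>a\<close>, and the perturbation adds only a tail of \<open>e\<close>. So after a time with
  \<open>norm (F (z l)) < a\<close> the norm stays below \<open>2 * a = eps\<close>.\<close>

lemma drift_vanishes:
  fixes F :: "'a::banach \<Rightarrow> 'a" and z e :: "nat \<Rightarrow> 'a"
  assumes K: "compact K" and F: "continuous_on K F"
    and z: "\<And>n. z n \<in> K"
    and rec: "\<And>n. z (Suc n) = z n + r n *\<^sub>R F (z n) + e n"
    and r: "\<And>n. r n \<ge> 0" and div: "\<not> summable r"
    and sumF: "summable (\<lambda>n. r n * (norm (F (z n)))\<^sup>2)"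
    and sume: "summable e"
    and step: "(\<lambda>n. dist (z (Suc n)) (z n)) \<longlonglongrightarrow> 0"
  shows "(\<lambda>n. F (z n)) \<longlonglongrightarrow> 0"
proof (rule LIMSEQ_I)
  fix eps :: real assume "eps > 0"
  define a where "a = eps / 2"
  have a: "a > 0" using \<open>eps > 0\<close> by (simp add: a_def)
  have "uniformly_continuous_on K F" using K F compact_uniformly_continuous by blast
  then obtain d where d: "d > 0"
    "\<And>x y. x \<in> K \<Longrightarrow> y \<in> K \<Longrightarrow> dist y x < d \<Longrightarrow> dist (F y) (F x) < a"
    using a unfolding uniformly_continuous_on_def by metis
  obtain N1 where N1: "\<And>m n. m \<ge> N1 \<Longrightarrow> norm (sum e {m..<n}) < d / 3"
    using sume d(1) unfolding summable_Cauchy by (metis divide_pos_pos zero_less_numeral)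
  \<comment> \<open>The factor \<open>a\<close> cancels the division by \<open>a\<close> in the
    estimate of the drift displacement, which leaves \<open>d / 3\<close>.\<close>
  obtain N2 where N2: "\<And>m n. m \<ge> N2 \<Longrightarrow> norm (\<Sum>k=m..<n. r k * (norm (F (z k)))\<^sup>2) < a * d / 3"
    using sumF d(1) a unfolding summable_Cauchy by (metis divide_pos_pos mult_pos_pos zero_less_numeral)
  obtain N3 where N3: "\<And>n. n \<ge> N3 \<Longrightarrow> dist (z (Suc n)) (z n) < d / 3"
    using order_tendstoD(2)[OF step, of "d/3"] d(1) unfolding eventually_sequentially by auto
  define N where "N = Max {N1, N2, N3}"
  have N: "N \<ge> N1" "N \<ge> N2" "N \<ge> N3" by (auto simp: N_def)
  obtain m where m: "m \<ge> N" "(norm (F (z m)))\<^sup>2 < a\<^sup>2"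
    using not_summable_frequently_small[OF r div sumF, of "a\<^sup>2" N] a by auto
  have m': "norm (F (z m)) < a" using m(2) a by (simp add: power2_less_imp_less)
  have "norm (F (z n)) < eps" if n: "n \<ge> m" for n
  proof -
    \<comment> \<open>\<open>l\<close> is the last time up to \<open>n\<close> at which the norm of
      the drift is below \<open>a\<close>.\<close>
    define l where "l = Max {k\<in>{m..n}. norm (F (z k)) < a}"
    have "l \<in> {k\<in>{m..n}. norm (F (z k)) < a}" unfolding l_def
      by (rule Max_in) (use m' n in auto)
    then have l: "m \<le> l" "l \<le> n" "norm (F (z l)) < a" by auto
    have above: "norm (F (z k)) \<ge> a" if "l < k" "k \<le> n" for k
    proof (rule ccontr)
      assume "\<not> ?thesis"
      then have "k \<le> l" unfolding l_def by (intro Max_ge) (use that l in auto)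
      then show False using that by simp
    qed
    have "dist (z n) (z l) < d"
    proof (cases "l = n")
      case True then show ?thesis using d by simp
    next
      case False
      then have ln: "Suc l \<le> n" using l by simp
      \<comment> \<open>The sum starts at \<open>Suc l\<close> because the lower bound
        \<open>a\<close> holds only after \<open>l\<close>; the single step out of
        \<open>z l\<close> is covered by \<open>N3\<close>.\<close>
      have tele: "z n - z (Suc l) = (\<Sum>k=Suc l..<n. r k *\<^sub>R F (z k)) + sum e {Suc l..<n}"
        using ln by (induction n rule: dec_induct) (auto simp: rec)
      have "norm (\<Sum>k=Suc l..<n. r k *\<^sub>R F (z k)) \<le> (\<Sum>k=Suc l..<n. r k * (norm (F (z k)))\<^sup>2 / a)"
      proof (rule sum_norm_le)
        fix k assume "k \<in> {Suc l..<n}"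
        then have "norm (F (z k)) \<ge> a" by (intro above) auto
        then have "norm (F (z k)) * a \<le> norm (F (z k)) * norm (F (z k))"
          by (intro mult_left_mono) auto
        then have "norm (F (z k)) \<le> (norm (F (z k)))\<^sup>2 / a"
          using a by (simp add: field_simps power2_eq_square)
        then have "r k * norm (F (z k)) \<le> r k * ((norm (F (z k)))\<^sup>2 / a)"
          by (rule mult_left_mono) (rule r)
        then show "norm (r k *\<^sub>R F (z k)) \<le> r k * (norm (F (z k)))\<^sup>2 / a" using r[of k] by simp
      qed
      also have "\<dots> = (\<Sum>k=Suc l..<n. r k * (norm (F (z k)))\<^sup>2) / a" by (rule sum_divide_distrib[symmetric])
      also have "\<dots> < d / 3"
        using N2[of "Suc l" n] N m(1) l(1) a by (simp add: field_simps)
      finally have "norm (z n - z (Suc l)) < d / 3 + d / 3"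
        unfolding tele using N1[of "Suc l" n] N m(1) l(1)
        by (intro norm_triangle_lt add_strict_mono) auto
      moreover have "dist (z (Suc l)) (z l) < d / 3" using N3[of l] N m(1) l(1) by simp
      moreover have "dist (z n) (z l) \<le> norm (z n - z (Suc l)) + dist (z (Suc l)) (z l)"
        unfolding dist_norm[symmetric] by metric
      ultimately show ?thesis by linarith
    qed
    then have "norm (F (z n) - F (z l)) < a" using d(2) z by (simp add: dist_norm)
    moreover have "norm (F (z n)) \<le> norm (F (z l)) + norm (F (z n) - F (z l))"
      by (rule norm_triangle_sub)
    ultimately show ?thesis using l(3) by (simp add: a_def)
  qed
  then show "\<exists>m. \<forall>n\<ge>m. norm (F (z n) - 0) < eps" by auto
qed

section \<open>Tangent inequality for primitives of monotone functions\<close>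

text \<open>A primitive of a monotone function is convex and lies above its tangents: the mean value
  theorem gives a slope \<open>f t\<close> with \<open>t\<close> between \<open>x\<close> and
  \<open>y\<close>, and monotonicity compares it with \<open>f x\<close>.\<close>

lemma convex_primitive_bound:
  fixes f G :: "real \<Rightarrow> real"
  assumes G: "\<And>x. x \<in> S \<Longrightarrow> (G has_real_derivative f x) (at x within S)"
    and S: "is_interval S" and f: "mono_on S f" and x: "x \<in> S" and y: "y \<in> S"
  shows "f x * (y - x) \<le> G y - G x"
proof -
  have mvt: "\<exists>t\<in>{a<..<b}. t \<in> S \<and> G b - G a = f t * (b - a)" if ab: "a < b" "a \<in> S" "b \<in> S" for a b
  proof -
    have sub: "{a..b} \<subseteq> S"
      using mem_is_interval_1_I[OF S ab(2,3)] by auto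
    have "(G has_derivative (*) (f t)) (at t within {a..b})" if "a \<le> t" "t \<le> b" for t
    proof -
      have "t \<in> S" using sub that by auto
      from G[OF this] show ?thesis
        unfolding has_field_derivative_def by (rule has_derivative_subset[OF _ sub])
    qed
    from mvt_simple[OF ab(1) this] obtain t where t: "t \<in> {a<..<b}" "G b - G a = f t * (b - a)"
      by auto
    moreover have "t \<in> S" using sub t(1) by auto
    ultimately show ?thesis by blast
  qed
  show ?thesis
  proof (cases x y rule: linorder_cases)
    case less
    then obtain t where t: "t \<in> {x<..<y}" "t \<in> S" "G y - G x = f t * (y - x)" using mvt x y by blast
    then have "f x \<le> f t" using f x by (auto intro: mono_onD)
    then show ?thesis unfolding t(3) using less by (intro mult_right_mono) auto
  next
    case greater
    then obtain t where t: "t \<in> {y<..<x}" "t \<in> S" "G x - G y = f t * (x - y)" using mvt x y by blast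
    then have "f t \<le> f x" using f x by (auto intro: mono_onD)
    then have "f t * (x - y) \<le> f x * (x - y)" using greater by (intro mult_right_mono) auto
    then show ?thesis using t(3) by (simp add: algebra_simps)
  qed simp
qed

subsection \<open>Almost sure convergence of orthogonal series\<close>

lemma card_cube_block: "real (card {j^3..<(Suc j)^3}) \<le> 3 * (real j + 1)\<^sup>2"
proof -
  have "real (card {j^3..<(Suc j)^3}) = (real j + 1)^3 - real j ^ 3"
    by (simp add: of_nat_diff power_mono add.commute)
  also have "\<dots> \<le> 3 * (real j + 1)\<^sup>2"
    by (simp add: power2_eq_square power3_eq_cube algebra_simps)
  finally show ?thesis .
qed

lemma inverse_le_on_cube_block:
  assumes "j^3 \<le> k"
  shows "1 / (real k + 1) \<le> 4 / (real j + 1)^3"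
proof -
  \<comment> \<open>This product is exactly \<open>4 * (j^3 + 1) - (j + 1)^3\<close>.\<close>
  have "0 \<le> (real j + 1) * (3 * (real j - 1)\<^sup>2)" by simp
  then have "(real j + 1)^3 \<le> 4 * (real j ^ 3 + 1)"
    by (simp add: power2_eq_square power3_eq_cube algebra_simps)
  also have "real j ^ 3 \<le> real k" using assms by (metis of_nat_le_iff of_nat_power)
  finally show ?thesis by (simp add: divide_simps)
qed

text \<open>The block sums give convergence along the cubes. Inside block \<open>j\<close> there are
  at most \<open>3 * (j + 1)^2\<close> terms of size at most \<open>4 * c / (j + 1)^3\<close>, so a
  partial block contributes only \<open>O (1 / j)\<close>.\<close>

lemma summable_of_cube_blocks:
  fixes x :: "nat \<Rightarrow> real"
  assumes bound: "\<And>n. \<bar>x n\<bar> \<le> c / (real n + 1)"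
    and blocks: "summable (\<lambda>j. \<Sum>k=j^3..<(Suc j)^3. x k)"
  shows "summable x"
proof -
  have c: "c \<ge> 0" using bound[of 0] by simp
  obtain s where s: "(\<lambda>n. \<Sum>j<n. \<Sum>k=j^3..<(Suc j)^3. x k) \<longlonglongrightarrow> s"
    using blocks unfolding summable_def sums_def by blast
  have "(\<Sum>j<n. \<Sum>k=j^3..<(Suc j)^3. x k) = (\<Sum>k<n^3. x k)" for n
  proof (induction n)
    case (Suc n)
    have "(\<Sum>k<n^3. x k) + (\<Sum>k=n^3..<(Suc n)^3. x k) = (\<Sum>k<(Suc n)^3. x k)"
      unfolding lessThan_atLeast0 by (intro sum.atLeastLessThan_concat power_mono) auto
    then show ?case using Suc by simp
  qed simp
  with s have s: "(\<lambda>n. \<Sum>k<n^3. x k) \<longlonglongrightarrow> s" by simp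
  have "(\<lambda>n. \<Sum>k<n. x k) \<longlonglongrightarrow> s"
  proof (rule LIMSEQ_I)
    fix e :: real assume e: "e > 0"
    obtain N1 where N1: "\<And>n. n \<ge> N1 \<Longrightarrow> norm ((\<Sum>k<n^3. x k) - s) < e / 2"
      using LIMSEQ_D[OF s, of "e / 2"] e by auto
    \<comment> \<open>Past \<open>24 * c / e\<close> the partial block bound
      \<open>12 * c / (j + 1)\<close> is below \<open>e / 2\<close>.\<close>
    obtain N2 where N2: "24 * c / e < real N2" using reals_Archimedean2 by blast
    define N where "N = max N1 N2"
    have "norm ((\<Sum>k<n. x k) - s) < e" if n: "n \<ge> N^3" for n
    proof -
      \<comment> \<open>The predecessor \<open>j\<close> of \<open>i\<close> is the index of the
        block that contains \<open>n\<close>.\<close>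
      define i where "i = (LEAST i. n < i^3)"
      have "n < (Suc n)^3" using self_le_power[of "Suc n" 3] by linarith
      then have i: "n < i^3" unfolding i_def by (rule LeastI)
      then obtain j where j: "i = Suc j" by (cases i) auto
      have "\<not> n < j^3" using not_less_Least[of j "\<lambda>i. n < i^3"] j unfolding i_def by auto
      then have jn: "j^3 \<le> n" by simp
      have "N^3 < (Suc j)^3" using le_less_trans[OF n i] unfolding j .
      then have "N \<le> j" using power_less_imp_less_base[of N 3 "Suc j"] by simp
      then have Nj: "N1 \<le> j" "real N2 \<le> real j" unfolding N_def by auto
      have "\<bar>\<Sum>k=j^3..<n. x k\<bar> \<le> (\<Sum>k=j^3..<n. 4 * c / (real j + 1)^3)"
      proof (rule order_trans[OF sum_abs sum_mono])
        fix k assume "k \<in> {j^3..<n}"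
        then have "c * (1 / (real k + 1)) \<le> c * (4 / (real j + 1)^3)"
          using c by (intro mult_left_mono inverse_le_on_cube_block) auto
        then show "\<bar>x k\<bar> \<le> 4 * c / (real j + 1)^3" using bound[of k] by (simp add: mult.commute)
      qed
      also have "\<dots> \<le> (\<Sum>k=j^3..<(Suc j)^3. 4 * c / (real j + 1)^3)"
        by (rule sum_mono2) (use i j c in auto)
      also have "\<dots> \<le> 3 * (real j + 1)\<^sup>2 * (4 * c / (real j + 1)^3)"
        unfolding sum_constant using card_cube_block[of j] c by (intro mult_right_mono) auto
      also have "\<dots> = 12 * c / (real j + 1)"
        by (simp add: divide_simps power2_eq_square power3_eq_cube)
      also have "\<dots> < e / 2"
      proof -
        have "24 * c < e * real N2" using N2 e by (simp add: field_simps)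
        also have "\<dots> \<le> e * (real j + 1)" using Nj e by (intro mult_left_mono) auto
        finally show ?thesis by (simp add: field_simps)
      qed
      finally have "\<bar>\<Sum>k=j^3..<n. x k\<bar> < e / 2" .
      moreover have "(\<Sum>k<n. x k) = (\<Sum>k<j^3. x k) + (\<Sum>k=j^3..<n. x k)"
        unfolding lessThan_atLeast0 using jn by (simp add: sum.atLeastLessThan_concat)
      moreover have "\<bar>(\<Sum>k<j^3. x k) - s\<bar> < e / 2" using N1[OF Nj(1)] by simp
      ultimately show ?thesis unfolding real_norm_def by linarith
    qed
    then show "\<exists>m. \<forall>n\<ge>m. norm ((\<Sum>k<n. x k) - s) < e" by blast
  qed
  then show ?thesis unfolding summable_def sums_def by blast
qed

section \<open>Random series and conditional probabilities\<close>

text \<open>Sum and integral of nonnegative terms may be exchanged, so the sum of the series has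
  finite integral and is finite almost everywhere.\<close>

lemma (in finite_measure) AE_summable_of_summable_integral:
  fixes Y :: "nat \<Rightarrow> 'a \<Rightarrow> real"
  assumes int: "\<And>n. integrable M (Y n)" and nonneg: "\<And>n x. Y n x \<ge> 0"
    and bound: "\<And>n. integral\<^sup>L M (Y n) \<le> b n" and sum: "summable b"
  shows "AE x in M. summable (\<lambda>n. Y n x)"
proof -
  have [measurable]: "Y n \<in> borel_measurable M" for n using int by auto
  have b: "b n \<ge> 0" for n
    using order_trans[OF integral_nonneg_AE bound, of n] nonneg by simp
  have "(\<integral>\<^sup>+x. (\<Sum>n. ennreal (Y n x)) \<partial>M) = (\<Sum>n. \<integral>\<^sup>+x. ennreal (Y n x) \<partial>M)"
    by (rule nn_integral_suminf) simp
  also have "\<dots> = (\<Sum>n. ennreal (integral\<^sup>L M (Y n)))"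
    using int nonneg by (simp add: nn_integral_eq_integral)
  also have "\<dots> \<le> (\<Sum>n. ennreal (b n))"
    by (intro suminf_le ennreal_leI bound) auto
  also have "\<dots> = ennreal (suminf b)" using suminf_ennreal2[OF b sum] by simp
  finally have "(\<integral>\<^sup>+x. (\<Sum>n. ennreal (Y n x)) \<partial>M) \<noteq> \<infinity>" by (auto simp: top_unique)
  from nn_integral_PInf_AE[OF _ this] show ?thesis
    by (auto intro!: summable_suminf_not_top nonneg elim!: eventually_mono)
qed

text \<open>With terms of order \<open>1 / n\<close> no maximal inequality is needed: almost sure convergence along the
  cubes follows from orthogonality, and the oscillation between consecutive cubes vanishes.\<close>

lemma (in prob_space) orthogonal_AE_summable:
  fixes X :: "nat \<Rightarrow> 'a \<Rightarrow> real"
  assumes meas [measurable]: "\<And>n. X n \<in> borel_measurable M"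
    and bound: "\<And>n x. x \<in> space M \<Longrightarrow> \<bar>X n x\<bar> \<le> c / (real n + 1)"
    and orth: "\<And>m n. m < n \<Longrightarrow> (\<integral>x. X m x * X n x \<partial>M) = 0"
  shows "AE x in M. summable (\<lambda>n. X n x)"
proof -
  define Y where "Y j x = (\<Sum>k=j^3..<(Suc j)^3. X k x)" for j x
  have [measurable]: "Y j \<in> borel_measurable M" for j unfolding Y_def by measurable
  obtain x0 where "x0 \<in> space M" using not_empty by blast
  from bound[OF this, of 0] have c: "c \<ge> 0" by simp
  have bX: "\<bar>X n x\<bar> \<le> c" if "x \<in> space M" for n x
  proof -
    have "c / (real n + 1) \<le> c" using c by (simp add: divide_le_eq mult_le_cancel_left1)
    then show ?thesis using bound[OF that, of n] by linarith
  qed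
  have intX: "integrable M (\<lambda>x. X m x * X n x)" for m n
  proof (rule integrable_const_bound[of _ "c * c"])
    show "AE x in M. norm (X m x * X n x) \<le> c * c"
      using bX c by (auto simp: abs_mult intro!: mult_mono)
  qed measurable
  have orth': "(\<integral>x. X m x * X n x \<partial>M) = 0" if "m \<noteq> n" for m n
    using that orth[of m n] orth[of n m] by (cases m n rule: linorder_cases) (auto simp: mult.commute)
  have Y2: "(Y j x)\<^sup>2 = (\<Sum>k=j^3..<(Suc j)^3. \<Sum>l=j^3..<(Suc j)^3. X k x * X l x)" for j x
    by (simp add: Y_def power2_eq_square sum_product)
  have intY: "integrable M (\<lambda>x. (Y j x)\<^sup>2)" for j
    unfolding Y2 by (intro Bochner_Integration.integrable_sum intX)
  \<comment> \<open>Orthogonality leaves only the diagonal: at most \<open>3 * (j + 1)^2\<close>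
    terms, each at most \<open>16 * c^2 / (j + 1)^6\<close>.\<close>
  have EY: "(\<integral>x. (Y j x)\<^sup>2 \<partial>M) \<le> 48 * c\<^sup>2 / (real j + 1)^4" for j
  proof -
    have "(\<integral>x. (Y j x)\<^sup>2 \<partial>M) =
        (\<Sum>k=j^3..<(Suc j)^3. \<Sum>l=j^3..<(Suc j)^3. \<integral>x. X k x * X l x \<partial>M)"
      unfolding Y2 by (simp add: intX)
    also have "\<dots> = (\<Sum>k=j^3..<(Suc j)^3. \<integral>x. X k x * X k x \<partial>M)"
    proof (intro sum.cong refl)
      fix k assume k: "k \<in> {j^3..<(Suc j)^3}"
      show "(\<Sum>l=j^3..<(Suc j)^3. \<integral>x. X k x * X l x \<partial>M) = (\<integral>x. X k x * X k x \<partial>M)"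
        by (subst sum.remove[OF _ k]) (auto intro!: sum.neutral orth')
    qed
    also have "\<dots> \<le> (\<Sum>k=j^3..<(Suc j)^3. (4 * c / (real j + 1)^3)\<^sup>2)"
    proof (rule sum_mono)
      fix k assume k: "k \<in> {j^3..<(Suc j)^3}"
      have b: "\<bar>X k x\<bar> \<le> 4 * c / (real j + 1)^3" if "x \<in> space M" for x
      proof -
        have "c * (1 / (real k + 1)) \<le> c * (4 / (real j + 1)^3)"
          using c k by (intro mult_left_mono inverse_le_on_cube_block) auto
        then show ?thesis using bound[OF that, of k] by (simp add: mult.commute)
      qed
      have "X k x * X k x \<le> (4 * c / (real j + 1)^3)\<^sup>2" if "x \<in> space M" for x
        using power_mono[OF b[OF that], of 2] by (simp add: power2_eq_square)
      then show "(\<integral>x. X k x * X k x \<partial>M) \<le> (4 * c / (real j + 1)^3)\<^sup>2"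
        by (intro integral_le_const intX AE_I2)
    qed
    also have "\<dots> \<le> 3 * (real j + 1)\<^sup>2 * (4 * c / (real j + 1)^3)\<^sup>2"
      unfolding sum_constant using card_cube_block[of j] by (intro mult_right_mono) auto
    also have "\<dots> = 48 * c\<^sup>2 / (real j + 1)^4"
      by (simp add: divide_simps power2_eq_square power3_eq_cube power4_eq_xxxx)
    finally show ?thesis .
  qed
  have sq: "summable (\<lambda>j. 1 / (real j + 1)\<^sup>2)"
    using summable_Suc_iff[of "\<lambda>j. inverse (real j ^ 2)"] inverse_power_summable[of 2, where 'a=real]
    by (simp add: field_simps)
  \<comment> \<open>The second moments decay like \<open>1 / (j + 1)^4\<close>, which leaves room
    for the weight \<open>(j + 1)^2\<close>; the weight is what later allows the passage from the
    squares to \<open>Y\<close> itself.\<close>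
  have "AE x in M. summable (\<lambda>j. (real j + 1)\<^sup>2 * (Y j x)\<^sup>2)"
  proof (rule AE_summable_of_summable_integral)
    show "(\<integral>x. (real j + 1)\<^sup>2 * (Y j x)\<^sup>2 \<partial>M) \<le> 48 * c\<^sup>2 * (1 / (real j + 1)\<^sup>2)" for j
    proof -
      have "(\<integral>x. (real j + 1)\<^sup>2 * (Y j x)\<^sup>2 \<partial>M) = (real j + 1)\<^sup>2 * (\<integral>x. (Y j x)\<^sup>2 \<partial>M)" by simp
      also have "\<dots> \<le> (real j + 1)\<^sup>2 * (48 * c\<^sup>2 / (real j + 1)^4)"
        by (intro mult_left_mono EY) simp
      also have "\<dots> = 48 * c\<^sup>2 * (1 / (real j + 1)\<^sup>2)"
        by (simp add: divide_simps power2_eq_square power4_eq_xxxx)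
      finally show ?thesis .
    qed
    show "summable (\<lambda>j. 48 * c\<^sup>2 * (1 / (real j + 1)\<^sup>2))" by (rule summable_mult[OF sq])
  qed (auto simp: intY)
  moreover have "summable (\<lambda>n. X n x)"
    if x: "x \<in> space M" and s: "summable (\<lambda>j. (real j + 1)\<^sup>2 * (Y j x)\<^sup>2)" for x
  proof (rule summable_of_cube_blocks)
    have "summable (\<lambda>j. Y j x)"
    proof (rule summable_comparison_test'[OF summable_add[OF s sq]])
      fix j
      \<comment> \<open>The inequality between arithmetic and geometric means bounds
        \<open>Y j x\<close> by two summable terms.\<close>
      have "0 \<le> ((real j + 1) * \<bar>Y j x\<bar> - 1 / (real j + 1))\<^sup>2" by simp
      also have "\<dots> = (real j + 1)\<^sup>2 * (Y j x)\<^sup>2 + 1 / (real j + 1)\<^sup>2 - 2 * \<bar>Y j x\<bar>"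
        by (simp add: power2_diff power_mult_distrib power_divide)
      finally show "norm (Y j x) \<le> (real j + 1)\<^sup>2 * (Y j x)\<^sup>2 + 1 / (real j + 1)\<^sup>2" by simp
    qed
    then show "summable (\<lambda>j. \<Sum>k=j^3..<(Suc j)^3. X k x)" unfolding Y_def .
  qed (rule bound[OF x])
  ultimately show ?thesis by (auto elim!: AE_mp)
qed

text \<open>A bounded \<open>G\<close>-measurable factor can be pulled into the conditional
  expectation, so \<open>indicator A\<close> may be replaced under the integral by its conditional
  probability, which is \<open>p\<close> almost everywhere.\<close>

lemma (in prob_space) cond_prob_residual_orthogonal:
  assumes sub: "subalgebra M G" and A: "A \<in> sets M"
    and Y: "Y \<in> borel_measurable G" and Y_bound: "\<And>x. x \<in> space M \<Longrightarrow> \<bar>Y x\<bar> \<le> B"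
    and p: "p \<in> borel_measurable M"
    and eq: "AE x in M. cond_prob_alg M G A x = p x"
  shows "(\<integral>x. Y x * (indicator A x - p x) \<partial>M) = 0"
proof -
  interpret finite_measure_subalgebra M G by unfold_locales (rule sub)
  have Y_meas [measurable]: "Y \<in> borel_measurable M" by (rule measurable_from_subalg[OF sub Y])
  note A [measurable]
  have int: "integrable M (\<lambda>x. Y x * indicator A x)"
  proof (rule integrable_const_bound[of _ B])
    show "AE x in M. norm (Y x * indicator A x) \<le> B"
      using Y_bound by (intro AE_I2) (force simp: indicator_def intro: order_trans[OF abs_ge_zero])
  qed measurable
  note * = real_cond_exp_intg[OF int Y borel_measurable_indicator[OF A]]
  have AE_eq: "AE x in M. Y x * real_cond_exp M G (indicator A) x = Y x * p x"
    using eq by eventually_elim (simp add: cond_prob_alg_def)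
  have int_p: "integrable M (\<lambda>x. Y x * p x)"
    using *(1) by (rule integrable_cong_AE_imp) (use p AE_eq in auto)
  have "(\<integral>x. Y x * p x \<partial>M) = (\<integral>x. Y x * real_cond_exp M G (indicator A) x \<partial>M)"
    by (rule integral_cong_AE) (use p AE_eq in auto)
  with * int int_p show ?thesis by (simp add: right_diff_distrib)
qed

subsection \<open>Interacting urns\<close>

locale urn_system = prob_space M for M :: "'a measure" +
  fixes Z I :: "nat \<Rightarrow> 'a \<Rightarrow> real^'n" and \<alpha> \<beta> q :: real and f :: "real \<Rightarrow> real" and r :: "nat \<Rightarrow> real"
  assumes alpha: "\<alpha> \<ge> 0" and beta: "\<beta> \<ge> 0" and alpha_beta: "\<alpha> + \<beta> \<le> 1"
    and q: "q \<in> {0..1}"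
    and f_range: "\<And>x. x \<in> {0..1} \<Longrightarrow> f x \<in> {0..1}"
    and f_mono: "mono_on {0..1} f"
    and f_cont: "continuous_on {0..1} f"
    and r_range: "\<And>n. r n \<in> {0..1}"
    and r_lim: "(\<lambda>n. real n * r n) \<longlonglongrightarrow> 1"
    and Z0_meas: "\<And>h. (\<lambda>\<omega>. Z 0 \<omega> $ h) \<in> borel_measurable M"
    and Z0_range: "\<And>h \<omega>. \<omega> \<in> space M \<Longrightarrow> Z 0 \<omega> $ h \<in> {0..1}"
    and I_meas: "\<And>n h. (\<lambda>\<omega>. I (Suc n) \<omega> $ h) \<in> borel_measurable M"
    and I_range: "\<And>n h \<omega>. \<omega> \<in> space M \<Longrightarrow> I (Suc n) \<omega> $ h \<in> {0, 1}"
    and Z_step: "\<And>n h \<omega>. \<omega> \<in> space M \<Longrightarrow>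
           Z (Suc n) \<omega> $ h = (1 - r n) * Z n \<omega> $ h + r n * I (Suc n) \<omega> $ h"
    and I_prob: "\<And>n h. AE \<omega> in M.
           cond_prob_alg M (hist_alg M Z I n) {\<omega> \<in> space M. I (Suc n) \<omega> $ h = 1} \<omega>
           = \<alpha> * vec_mean (Z n \<omega>) + \<beta> * q + (1 - \<alpha> - \<beta>) * f (Z n \<omega> $ h)"
begin

section \<open>The cube, the drift and the noise\<close>

abbreviation "cube \<equiv> {z::real^'n. \<forall>h. z $ h \<in> {0..1}}"

abbreviation "F \<equiv> (drift \<alpha> \<beta> q f :: real^'n \<Rightarrow> real^'n)"

text \<open>The components of \<open>Z n + F (Z n)\<close> are the conditional probabilities in
  \<open>I_prob\<close>, so this is \<open>I (Suc n)\<close> minus its conditional mean given the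
  history up to \<open>n\<close>. Note the shift: \<open>noise n\<close> is known only at time
  \<open>Suc n\<close>.\<close>

definition noise :: "nat \<Rightarrow> 'a \<Rightarrow> real^'n" where
  "noise n \<omega> = I (Suc n) \<omega> - Z n \<omega> - F (Z n \<omega>)"

lemma cube_eq_cbox: "cube = cbox 0 1"
  by (auto simp: mem_box_cart)

lemma compact_cube: "compact cube"
  unfolding cube_eq_cbox by (rule compact_cbox)

lemma vec_mean_range: "z \<in> cube \<Longrightarrow> vec_mean z \<in> {0..1}"
proof -
  assume z: "z \<in> cube"
  then have "(\<Sum>i\<in>UNIV. z $ i) \<le> (\<Sum>i\<in>(UNIV::'n set). 1)" by (intro sum_mono) auto
  moreover have "(\<Sum>i\<in>UNIV. z $ i) \<ge> 0" using z by (intro sum_nonneg) auto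
  ultimately show ?thesis by (simp add: vec_mean_def)
qed

lemma drift_nth: "F z $ h = \<alpha> * vec_mean z + \<beta> * q + (1 - \<alpha> - \<beta>) * f (z $ h) - z $ h"
  by (simp add: drift_def)

text \<open>\<open>z $ h + F z $ h\<close> is a convex combination of the mean, \<open>q\<close> and
  \<open>f (z $ h)\<close>, with weights \<alpha>, \<beta> and
  \<open>1 - \<alpha> - \<beta>\<close>.\<close>

lemma drift_range: 
  assumes "z \<in> cube"
  shows "z $ h + F z $ h \<in> {0..1}" "\<bar>F z $ h\<bar> \<le> 1"
proof -
  have m: "vec_mean z \<in> {0..1}" and fz: "f (z $ h) \<in> {0..1}" and zh: "z $ h \<in> {0..1}"
    using assms vec_mean_range f_range by auto
  have "0 \<le> \<alpha> * vec_mean z" "\<alpha> * vec_mean z \<le> \<alpha>" "0 \<le> \<beta> * q" "\<beta> * q \<le> \<beta>"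
    "0 \<le> (1 - \<alpha> - \<beta>) * f (z $ h)" "(1 - \<alpha> - \<beta>) * f (z $ h) \<le> 1 - \<alpha> - \<beta>"
    using m fz q alpha beta alpha_beta by (auto intro: mult_left_le)
  then show *: "z $ h + F z $ h \<in> {0..1}" by (simp add: drift_nth)
  then show "\<bar>F z $ h\<bar> \<le> 1" using zh by auto
qed

lemma continuous_on_drift: "continuous_on cube F"
proof -
  have "continuous_on cube (\<lambda>z. f (z $ h))" for h
    by (rule continuous_on_compose2[OF f_cont]) (auto intro!: continuous_intros)
  then show ?thesis
    unfolding drift_def vec_mean_def by (intro continuous_intros continuous_on_vec_lambda) auto
qed

lemma Z_in_cube: "\<omega> \<in> space M \<Longrightarrow> Z n \<omega> \<in> cube"
proof (induction n)
  case (Suc n)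
  have "Z (Suc n) \<omega> $ h \<in> {0..1}" for h
  proof -
    have zh: "Z n \<omega> $ h \<in> {0..1}" and Ih: "I (Suc n) \<omega> $ h \<in> {0..1}" and rn: "r n \<in> {0..1}"
      using Suc I_range[of \<omega> n h] r_range[of n] by auto
    have "(1 - r n) * Z n \<omega> $ h \<le> 1 - r n" "r n * I (Suc n) \<omega> $ h \<le> r n"
      using zh Ih rn by (auto intro: mult_left_le)
    then show ?thesis using zh Ih rn Z_step[OF Suc.prems, of n h] by simp
  qed
  then show ?case by simp
qed (use Z0_range in auto)

lemma noise_bound: "\<omega> \<in> space M \<Longrightarrow> \<bar>noise n \<omega> $ h\<bar> \<le> 1"
  using drift_range(1)[OF Z_in_cube, of \<omega> n h] I_range[of \<omega> n h] by (auto simp: noise_def)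

lemma Z_Suc:
  "\<omega> \<in> space M \<Longrightarrow> Z (Suc n) \<omega> = Z n \<omega> + r n *\<^sub>R F (Z n \<omega>) + r n *\<^sub>R noise n \<omega>"
  by (simp add: vec_eq_iff Z_step noise_def algebra_simps)

lemma Z_step_bound: "\<omega> \<in> space M \<Longrightarrow> \<bar>Z (Suc n) \<omega> $ h - Z n \<omega> $ h\<bar> \<le> r n"
proof -
  assume \<omega>: "\<omega> \<in> space M"
  have "\<bar>I (Suc n) \<omega> $ h - Z n \<omega> $ h\<bar> \<le> 1"
    using Z_in_cube[OF \<omega>, of n] I_range[OF \<omega>, of n h] by (auto dest!: spec[of _ h])
  then have "r n * \<bar>I (Suc n) \<omega> $ h - Z n \<omega> $ h\<bar> \<le> r n"
    using r_range[of n] by (intro mult_left_le) auto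
  moreover have "Z (Suc n) \<omega> $ h - Z n \<omega> $ h = r n * (I (Suc n) \<omega> $ h - Z n \<omega> $ h)"
    using Z_step[OF \<omega>] by (simp add: algebra_simps)
  ultimately show ?thesis using r_range[of n] by (simp add: abs_mult)
qed

section \<open>Measurability with respect to the history\<close>

lemma space_hist: "space (hist_alg M Z I n) = space M"
  unfolding hist_alg_def by (rule space_measure_of) auto

lemma sets_hist: "sets (hist_alg M Z I n) = sigma_sets (space M)
     ({(\<lambda>\<omega>. Z 0 \<omega> $ h) -` A \<inter> space M | h A. A \<in> sets borel} \<union>
      {(\<lambda>\<omega>. I k \<omega> $ h) -` A \<inter> space M | k h A. k \<in> {1..n} \<and> A \<in> sets borel})"
  unfolding hist_alg_def by (rule sets_measure_of) auto

lemma subalgebra_hist: "subalgebra M (hist_alg M Z I n)"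
  unfolding subalgebra_def space_hist sets_hist
proof (intro conjI refl sets.sigma_sets_subset)
  have "(\<lambda>\<omega>. I k \<omega> $ h) -` A \<inter> space M \<in> sets M" if "k \<in> {1..n}" "A \<in> sets borel" for k h A
    using measurable_sets[OF I_meas[of "k - 1" h] that(2)] that(1) by simp
  then show "{(\<lambda>\<omega>. Z 0 \<omega> $ h) -` A \<inter> space M | h A. A \<in> sets borel} \<union>
      {(\<lambda>\<omega>. I k \<omega> $ h) -` A \<inter> space M | k h A. k \<in> {1..n} \<and> A \<in> sets borel} \<subseteq> sets M"
    using measurable_sets[OF Z0_meas] by auto
qed

lemma I_hist_measurable:
  assumes "k < n" shows "(\<lambda>\<omega>. I (Suc k) \<omega> $ h) \<in> borel_measurable (hist_alg M Z I n)"
proof (rule measurableI)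
  fix A :: "real set" assume "A \<in> sets borel"
  moreover have "Suc k \<in> {1..n}" using assms by auto
  ultimately show "(\<lambda>\<omega>. I (Suc k) \<omega> $ h) -` A \<inter> space (hist_alg M Z I n) \<in> sets (hist_alg M Z I n)"
    unfolding space_hist sets_hist by (intro sigma_sets.Basic UnI2) blast
qed simp

lemma Z_hist_measurable:
  "k \<le> n \<Longrightarrow> (\<lambda>\<omega>. Z k \<omega> $ h) \<in> borel_measurable (hist_alg M Z I n)"
proof (induction k)
  case 0
  show ?case
  proof (rule measurableI)
    fix A :: "real set" assume "A \<in> sets borel"
    then show "(\<lambda>\<omega>. Z 0 \<omega> $ h) -` A \<inter> space (hist_alg M Z I n) \<in> sets (hist_alg M Z I n)"
      unfolding space_hist sets_hist by (intro sigma_sets.Basic UnI1) blast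
  qed simp
next
  case (Suc k)
  then have "(\<lambda>\<omega>. (1 - r k) * Z k \<omega> $ h + r k * I (Suc k) \<omega> $ h) \<in> borel_measurable (hist_alg M Z I n)"
    by (intro borel_measurable_add borel_measurable_times borel_measurable_const I_hist_measurable) auto
  then show ?case by (rule measurable_cong[THEN iffD1, rotated]) (simp add: Z_step space_hist)
qed

text \<open>Nothing is known about \<open>f\<close> outside the unit interval, so measurability goes through its
  extension by constants.\<close>

lemma drift_hist_measurable:
  assumes "k \<le> n" shows "(\<lambda>\<omega>. F (Z k \<omega>) $ h) \<in> borel_measurable (hist_alg M Z I n)"
proof -
  note [measurable] = Z_hist_measurable[OF assms]
  define g where "g x = f (max 0 (min 1 x))" for x
  have "continuous_on UNIV g"
    unfolding g_def by (rule continuous_on_compose2[OF f_cont]) (auto intro!: continuous_intros)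
  then have [measurable]: "g \<in> borel_measurable borel" by (rule borel_measurable_continuous_onI)
  have "(\<lambda>\<omega>. \<alpha> * vec_mean (Z k \<omega>) + \<beta> * q + (1 - \<alpha> - \<beta>) * g (Z k \<omega> $ h) - Z k \<omega> $ h)
      \<in> borel_measurable (hist_alg M Z I n)"
    unfolding vec_mean_def by measurable
  then show ?thesis
  proof (rule measurable_cong[THEN iffD1, rotated])
    fix \<omega> assume "\<omega> \<in> space (hist_alg M Z I n)"
    then have "Z k \<omega> $ h \<in> {0..1}" using Z_in_cube[of \<omega> k] by (simp add: space_hist)
    then have "g (Z k \<omega> $ h) = f (Z k \<omega> $ h)" by (simp add: g_def)
    then show "\<alpha> * vec_mean (Z k \<omega>) + \<beta> * q + (1 - \<alpha> - \<beta>) * g (Z k \<omega> $ h) - Z k \<omega> $ h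
        = F (Z k \<omega>) $ h" by (simp add: drift_nth)
  qed
qed

text \<open>The inequality is strict because \<open>noise k\<close> contains
  \<open>I (Suc k)\<close>.\<close>

lemma noise_hist_measurable:
  assumes "k < n" shows "(\<lambda>\<omega>. noise k \<omega> $ h) \<in> borel_measurable (hist_alg M Z I n)"
  unfolding noise_def vector_minus_component using assms
  by (intro borel_measurable_diff I_hist_measurable Z_hist_measurable drift_hist_measurable) auto

section \<open>Orthogonality of the noise to the past\<close>

text \<open>As \<open>I (Suc n)\<close> has components in \<open>{0, 1}\<close>, each component is
  the indicator of the event that it equals one; the noise is then the residual of a conditional
  probability.\<close>

lemma noise_orthogonal:
  assumes Y: "Y \<in> borel_measurable (hist_alg M Z I n)" and bound: "\<And>\<omega>. \<omega> \<in> space M \<Longrightarrow> \<bar>Y \<omega>\<bar> \<le> B"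
  shows "(\<integral>\<omega>. Y \<omega> * noise n \<omega> $ h \<partial>M) = 0"
proof -
  define A where "A = {\<omega> \<in> space M. I (Suc n) \<omega> $ h = 1}"
  define p where "p \<omega> = Z n \<omega> $ h + F (Z n \<omega>) $ h" for \<omega>
  note from_hist = measurable_from_subalg[OF subalgebra_hist]
  have A: "A \<in> sets M" unfolding A_def
    using measurable_sets[OF I_meas[of n h], of "{1}"] by (simp add: vimage_def Int_def conj_commute)
  have p: "p \<in> borel_measurable M" unfolding p_def
    by (intro borel_measurable_add from_hist[OF Z_hist_measurable[of n n]]
        from_hist[OF drift_hist_measurable[of n n]]) simp_all
  have "(\<integral>\<omega>. Y \<omega> * (indicator A \<omega> - p \<omega>) \<partial>M) = 0"
  proof (rule cond_prob_residual_orthogonal[OF subalgebra_hist A Y bound p])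
    show "AE x in M. cond_prob_alg M (hist_alg M Z I n) A x = p x"
      using I_prob[of n h] unfolding A_def by eventually_elim (simp add: p_def drift_nth)
  qed
  also have "(\<integral>\<omega>. Y \<omega> * (indicator A \<omega> - p \<omega>) \<partial>M) = (\<integral>\<omega>. Y \<omega> * noise n \<omega> $ h \<partial>M)"
  proof (rule Bochner_Integration.integral_cong[OF refl])
    fix \<omega> assume \<omega>: "\<omega> \<in> space M"
    then have "indicator A \<omega> = I (Suc n) \<omega> $ h"
      using I_range[OF \<omega>, of n h] by (auto simp: A_def indicator_def)
    then show "Y \<omega> * (indicator A \<omega> - p \<omega>) = Y \<omega> * noise n \<omega> $ h"
      by (simp add: noise_def p_def algebra_simps)
  qed
  finally show ?thesis .
qed

text \<open>This is a martingale transform: the weight \<open>g n\<close> is known at time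
  \<open>n\<close>, so distinct terms are orthogonal, and bounded noise makes them of order
  \<open>1 / n\<close>.\<close>

lemma noise_transform_summable:
  fixes g :: "nat \<Rightarrow> 'a \<Rightarrow> real^'n"
  assumes meas: "\<And>n h. (\<lambda>\<omega>. g n \<omega> $ h) \<in> borel_measurable (hist_alg M Z I n)"
    and bound: "\<And>n h \<omega>. \<omega> \<in> space M \<Longrightarrow> \<bar>g n \<omega> $ h\<bar> \<le> c / (real n + 1)"
  shows "AE \<omega> in M. summable (\<lambda>n. g n \<omega> \<bullet> noise n \<omega>)"
proof (rule orthogonal_AE_summable)
  have hist: "(\<lambda>\<omega>. g m \<omega> \<bullet> noise m \<omega>) \<in> borel_measurable (hist_alg M Z I n)" if "m < n" for m n
  proof -
    have "(\<lambda>\<omega>. g m \<omega> $ h) \<in> borel_measurable (hist_alg M Z I n)" for h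
    proof -
      have "k \<in> {1..n}" if "k \<in> {1..m}" for k using that \<open>m < n\<close> by simp
      then have "subalgebra (hist_alg M Z I n) (hist_alg M Z I m)"
        unfolding subalgebra_def space_hist sets_hist
        by (intro conjI refl sigma_sets_mono' Un_mono subset_refl) blast
      from measurable_from_subalg[OF this meas] show ?thesis .
    qed
    then show ?thesis
      unfolding inner_vec_def inner_real_def
      by (intro borel_measurable_sum borel_measurable_times noise_hist_measurable that)
  qed
  show meas_M: "(\<lambda>\<omega>. g n \<omega> \<bullet> noise n \<omega>) \<in> borel_measurable M" for n
    by (rule measurable_from_subalg[OF subalgebra_hist hist[of n "Suc n"]]) simp
  show X_bound: "\<bar>g n \<omega> \<bullet> noise n \<omega>\<bar> \<le> (real CARD('n) * c) / (real n + 1)" if "\<omega> \<in> space M" for n \<omega>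
  proof -
    have "\<bar>g n \<omega> \<bullet> noise n \<omega>\<bar> \<le> (\<Sum>h\<in>(UNIV::'n set). c / (real n + 1))"
      unfolding inner_vec_def inner_real_def
    proof (rule order_trans[OF sum_abs sum_mono])
      fix h show "\<bar>g n \<omega> $ h * noise n \<omega> $ h\<bar> \<le> c / (real n + 1)"
        using mult_mono[OF bound[OF that, of n h] noise_bound[OF that, of n h]]
          order_trans[OF abs_ge_zero bound[OF that, of n h]]
        by (simp add: abs_mult)
    qed
    then show ?thesis by simp
  qed
  show "(\<integral>\<omega>. (g m \<omega> \<bullet> noise m \<omega>) * (g n \<omega> \<bullet> noise n \<omega>) \<partial>M) = 0" if "m < n" for m n
  proof -
    \<comment> \<open>\<open>?Y h\<close> collects every factor known at time \<open>n\<close>,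
      which leaves a single component of \<open>noise n\<close> to integrate against it.\<close>
    let ?Y = "\<lambda>h \<omega>. (g m \<omega> \<bullet> noise m \<omega>) * g n \<omega> $ h"
    have Y: "?Y h \<in> borel_measurable (hist_alg M Z I n)" for h
      by (intro borel_measurable_times hist that meas)
    let ?B = "(real CARD('n) * c) / (real m + 1) * (c / (real n + 1))"
    have B: "\<bar>?Y h \<omega>\<bar> \<le> ?B" if "\<omega> \<in> space M" for h \<omega>
      unfolding abs_mult
      by (rule mult_mono[OF X_bound[OF that] bound[OF that] order_trans[OF abs_ge_zero X_bound[OF that]]]) simp
    have "integrable M (\<lambda>\<omega>. ?Y h \<omega> * noise n \<omega> $ h)" for h
    proof (rule integrable_const_bound[of _ "?B"])
      show "AE \<omega> in M. norm (?Y h \<omega> * noise n \<omega> $ h) \<le> ?B"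
      proof (rule AE_I2)
        fix \<omega> assume \<omega>: "\<omega> \<in> space M"
        have "\<bar>?Y h \<omega>\<bar> * \<bar>noise n \<omega> $ h\<bar> \<le> \<bar>?Y h \<omega>\<bar>"
          by (intro mult_left_le noise_bound \<omega>) simp
        then show "norm (?Y h \<omega> * noise n \<omega> $ h) \<le> ?B"
          using B[OF \<omega>, of h] unfolding real_norm_def abs_mult[of "?Y h \<omega>"] by linarith
      qed
      show "(\<lambda>\<omega>. ?Y h \<omega> * noise n \<omega> $ h) \<in> borel_measurable M"
        by (intro borel_measurable_times[OF measurable_from_subalg[OF subalgebra_hist Y]]
            measurable_from_subalg[OF subalgebra_hist noise_hist_measurable[of n "Suc n"]]) simp
    qed
    then have "(\<integral>\<omega>. (\<Sum>h\<in>UNIV. ?Y h \<omega> * noise n \<omega> $ h) \<partial>M) = 0"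
      using noise_orthogonal[OF Y B] by simp
    then show ?thesis
      unfolding inner_vec_def[of "g n _"] inner_real_def sum_distrib_left by (simp add: mult.assoc)
  qed
qed

section \<open>Asymptotics of the step sizes\<close>

lemma r_bound: "\<exists>c. \<forall>n. r n \<le> c / (real n + 1)"
proof -
  obtain B where B: "\<And>n. norm (real n * r n) \<le> B"
    using convergent_imp_Bseq[of "\<lambda>n. real n * r n"] r_lim by (auto simp: convergent_def Bseq_def)
  \<comment> \<open>\<open>(n + 1) * r n\<close> splits into \<open>n * r n\<close>, at most
    \<open>B\<close>, and \<open>r n\<close>, at most one.\<close>
  have "r n \<le> (B + 1) / (real n + 1)" for n
    using B[of n] r_range[of n] by (simp add: divide_simps algebra_simps)
  then show ?thesis by blast
qed

lemma r_tendsto_0: "r \<longlonglongrightarrow> 0"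
proof -
  obtain c where c: "\<And>n. r n \<le> c / (real n + 1)" using r_bound by blast
  have "(\<lambda>n. c / (real n + 1)) \<longlonglongrightarrow> 0"
    using tendsto_mult_right_zero[OF LIMSEQ_inverse_real_of_nat, of c] by (simp add: field_simps)
  then show ?thesis
    by (rule real_tendsto_sandwich[rotated 2, OF tendsto_const]) (use c r_range in auto)
qed

text \<open>Eventually \<open>n * r n\<close> exceeds one half, so \<open>2 * r n\<close> dominates
  the harmonic series.\<close>

lemma r_not_summable: "\<not> summable r"
proof
  assume "summable r"
  then have s: "summable (\<lambda>n. 2 * r n)" by (rule summable_mult)
  have "eventually (\<lambda>n. norm (inverse (real n)) \<le> 2 * r n) sequentially"
    using order_tendstoD(1)[OF r_lim, of "1/2", simplified] eventually_gt_at_top[of 0]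
    by eventually_elim (simp add: field_simps)
  from summable_comparison_test_ev[OF this s] show False
    using not_summable_harmonic[where 'a=real] by simp
qed

lemma r_square_summable: "summable (\<lambda>n. (r n)\<^sup>2)"
proof -
  obtain c where c: "\<And>n. r n \<le> c / (real n + 1)" using r_bound by blast
  have "summable (\<lambda>j. c\<^sup>2 * inverse (real (Suc j) ^ 2))"
    using summable_Suc_iff[of "\<lambda>j. inverse (real j ^ 2)"] inverse_power_summable[of 2, where 'a=real]
    by (intro summable_mult) simp
  then show ?thesis
  proof (rule summable_comparison_test'[of _ 0])
    fix n
    have "(r n)\<^sup>2 \<le> (c / (real n + 1))\<^sup>2" using c r_range[of n] by (intro power_mono) auto
    then show "norm ((r n)\<^sup>2) \<le> c\<^sup>2 * inverse (real (Suc n) ^ 2)"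
      by (simp add: power_mult_distrib power_inverse divide_inverse add.commute)
  qed
qed

section \<open>Zeros and potential of the drift\<close>

text \<open>On the diagonal the mean is \<open>x\<close> itself and all components of the drift
  equal one scalar function, which is nonnegative at 0 and nonpositive at 1.\<close>

lemma diagonal_zero_exists: "\<exists>x\<in>{0..1}. x *\<^sub>R 1 \<in> (drift_zeros \<alpha> \<beta> q f :: (real^'n) set)"
proof -
  let ?g = "\<lambda>x. \<alpha> * x + \<beta> * q + (1 - \<alpha> - \<beta>) * f x - x"
  have f01: "f 0 \<ge> 0" "f 1 \<le> 1" using f_range[of 0] f_range[of 1] by auto
  have "?g 0 \<ge> 0" using f01 alpha beta alpha_beta q by auto
  moreover have "?g 1 \<le> 0"
  proof -
    have "\<beta> * q \<le> \<beta>" using q beta by (auto intro: mult_left_le)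
    moreover have "(1 - \<alpha> - \<beta>) * f 1 \<le> 1 - \<alpha> - \<beta>" using f01 alpha_beta by (auto intro: mult_left_le)
    ultimately show ?thesis by simp
  qed
  moreover have "continuous_on {0..1} ?g" by (intro continuous_intros f_cont)
  ultimately obtain x where x: "0 \<le> x" "x \<le> 1" "?g x = 0"
    using IVT2'[of ?g 1 0 0] by auto
  have "vec_mean (x *\<^sub>R (1::real^'n)) = x" by (simp add: vec_mean_def)
  then have "x *\<^sub>R 1 \<in> (drift_zeros \<alpha> \<beta> q f :: (real^'n) set)"
    using x by (simp add: drift_zeros_def vec_eq_iff drift_nth)
  then show ?thesis using x by auto
qed

lemma drift_zeros_eq: "drift_zeros \<alpha> \<beta> q f = {z \<in> cube. F z = 0}"
  by (auto simp: drift_zeros_def)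

text \<open>Each partial derivative of \<open>vec_mean\<close> is one over the dimension; the factor
  \<open>CARD('n)\<close> compensates this, so that the first term contributes
  \<open>\<alpha> * vec_mean z\<close> to every component of the gradient. \<open>G\<close> stands
  for a primitive of \<open>f\<close>.\<close>

definition potential :: "(real \<Rightarrow> real) \<Rightarrow> real^'n \<Rightarrow> real" where
  "potential G z = \<alpha> * real CARD('n) / 2 * (vec_mean z)\<^sup>2 +
     (\<Sum>h\<in>UNIV. \<beta> * q * z $ h + (1 - \<alpha> - \<beta>) * G (z $ h) - (z $ h)\<^sup>2 / 2)"

text \<open>The drift is the gradient of the potential, and the potential is convex up to the term
  \<open>- norm z ^ 2 / 2\<close> since \<open>f\<close> increases; so the second order error is explicit.\<close>

lemma potential_increase:
  assumes G: "\<And>x. x \<in> {0..1} \<Longrightarrow> (G has_real_derivative f x) (at x within {0..1})"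
    and x: "x \<in> cube" and y: "y \<in> cube"
  shows "F x \<bullet> (y - x) - (\<Sum>h\<in>UNIV. (y $ h - x $ h)\<^sup>2) / 2 \<le> potential G y - potential G x"
proof -
  let ?N = "real CARD('n)" and ?c = "1 - \<alpha> - \<beta>"
  let ?m = "vec_mean x" and ?m' = "vec_mean y"
  let ?t = "\<lambda>z h. \<beta> * q * z $ h + ?c * G (z $ h) - (z $ h)\<^sup>2 / 2"
  have mean: "?N * (?m' - ?m) = (\<Sum>h\<in>UNIV. y $ h - x $ h)"
    by (simp add: vec_mean_def sum_subtractf field_simps)
  \<comment> \<open>Convexity of the squared mean, in the form of its tangent inequality.\<close>
  have "0 \<le> \<alpha> * ?N / 2 * (?m' - ?m)\<^sup>2" using alpha by simp
  then have "\<alpha> * ?m * (?N * (?m' - ?m)) \<le> \<alpha> * ?N / 2 * ?m'\<^sup>2 - \<alpha> * ?N / 2 * ?m\<^sup>2"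
    by (simp add: power2_eq_square field_simps)
  then have A: "(\<Sum>h\<in>UNIV. \<alpha> * ?m * (y $ h - x $ h)) \<le> \<alpha> * ?N / 2 * ?m'\<^sup>2 - \<alpha> * ?N / 2 * ?m\<^sup>2"
    unfolding mean by (simp add: sum_distrib_left)
  have B: "(\<beta> * q + ?c * f (x $ h) - x $ h) * (y $ h - x $ h) - (y $ h - x $ h)\<^sup>2 / 2 \<le> ?t y h - ?t x h" for h
  proof -
    have "f (x $ h) * (y $ h - x $ h) \<le> G (y $ h) - G (x $ h)"
      by (rule convex_primitive_bound[OF G _ f_mono]) (use x y in auto)
    then have "?c * (f (x $ h) * (y $ h - x $ h)) \<le> ?c * (G (y $ h) - G (x $ h))"
      using alpha_beta by (intro mult_left_mono) auto
    \<comment> \<open>The concave part is quadratic, so its second order expansion is exact; this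
      produces the error term of the statement.\<close>
    moreover have "- (x $ h) * (y $ h - x $ h) - (y $ h - x $ h)\<^sup>2 / 2 = (x $ h)\<^sup>2 / 2 - (y $ h)\<^sup>2 / 2"
      by (simp add: power2_eq_square field_simps)
    ultimately show ?thesis by (simp add: algebra_simps)
  qed
  have "F x \<bullet> (y - x) - (\<Sum>h\<in>UNIV. (y $ h - x $ h)\<^sup>2) / 2
      = (\<Sum>h\<in>UNIV. \<alpha> * ?m * (y $ h - x $ h)) +
        (\<Sum>h\<in>UNIV. (\<beta> * q + ?c * f (x $ h) - x $ h) * (y $ h - x $ h) - (y $ h - x $ h)\<^sup>2 / 2)"
    unfolding inner_vec_def inner_real_def sum_divide_distrib sum_subtractf[symmetric] sum.distrib[symmetric]
    by (intro sum.cong refl) (simp add: drift_nth algebra_simps)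
  also have "\<dots> \<le> (\<alpha> * ?N / 2 * ?m'\<^sup>2 - \<alpha> * ?N / 2 * ?m\<^sup>2) + (\<Sum>h\<in>UNIV. ?t y h - ?t x h)"
    by (intro add_mono A sum_mono B)
  also have "\<dots> = potential G y - potential G x"
    by (simp add: potential_def sum_subtractf)
  finally show ?thesis .
qed

text \<open>Summing the increments of the potential telescopes. The potential is bounded on the cube
  and the errors form a convergent series, so the partial sums of the nonnegative terms are
  bounded.\<close>

lemma summable_weighted_drift:
  assumes G: "\<And>x. x \<in> {0..1} \<Longrightarrow> (G has_real_derivative f x) (at x within {0..1})"
    and \<omega>: "\<omega> \<in> space M"
    and noise: "summable (\<lambda>n. (r n *\<^sub>R F (Z n \<omega>)) \<bullet> noise n \<omega>)"
  shows "summable (\<lambda>n. r n * (norm (F (Z n \<omega>)))\<^sup>2)"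
proof -
  let ?V = "\<lambda>n. potential G (Z n \<omega>)"
  \<comment> \<open>The first term bounds the second order error, as every coordinate moves by at
    most \<open>r n\<close>; the second removes the noise part of the increment.\<close>
  let ?e = "\<lambda>n. real CARD('n) / 2 * (r n)\<^sup>2 - (r n *\<^sub>R F (Z n \<omega>)) \<bullet> noise n \<omega>"
  have "continuous_on {0..1} G" using G by (intro DERIV_continuous_on) auto
  then have "continuous_on cube (\<lambda>z. G (z $ h))" for h
    by (rule continuous_on_compose2) (auto intro!: continuous_intros)
  then have "continuous_on cube (potential G)"
    unfolding potential_def vec_mean_def by (intro continuous_intros) auto
  then have "bounded (potential G ` cube)"
    by (intro compact_imp_bounded compact_continuous_image compact_cube)
  then obtain B where "\<forall>v\<in>potential G ` cube. norm v \<le> B" unfolding bounded_iff by blast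
  then have B: "\<bar>?V n\<bar> \<le> B" for n
    using Z_in_cube[OF \<omega>, of n] unfolding real_norm_def by blast
  have "summable ?e" by (intro summable_diff summable_mult r_square_summable noise)
  then have "Bseq (\<lambda>n. \<Sum>k<n. ?e k)"
    by (intro convergent_imp_Bseq) (simp add: summable_iff_convergent)
  then obtain E where E: "\<And>n. \<bar>\<Sum>k<n. ?e k\<bar> \<le> E" unfolding Bseq_def by auto
  have step: "r n * (norm (F (Z n \<omega>)))\<^sup>2 \<le> ?V (Suc n) - ?V n + ?e n" for n
  proof -
    have "(\<Sum>h\<in>UNIV. (Z (Suc n) \<omega> $ h - Z n \<omega> $ h)\<^sup>2) \<le> (\<Sum>h\<in>(UNIV::'n set). (r n)\<^sup>2)"
      using power_mono[OF Z_step_bound[OF \<omega>], of n _ 2] by (intro sum_mono) simp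
    moreover have "F (Z n \<omega>) \<bullet> (Z (Suc n) \<omega> - Z n \<omega>) =
        r n * (norm (F (Z n \<omega>)))\<^sup>2 + (r n *\<^sub>R F (Z n \<omega>)) \<bullet> noise n \<omega>"
      by (simp add: Z_Suc[OF \<omega>] inner_add_right power2_norm_eq_inner)
    ultimately show ?thesis
      using potential_increase[OF G Z_in_cube[OF \<omega>, of n] Z_in_cube[OF \<omega>, of "Suc n"]] by simp
  qed
  show ?thesis
  proof (rule summableI_nonneg_bounded)
    fix n
    have "(\<Sum>k<n. r k * (norm (F (Z k \<omega>)))\<^sup>2) \<le> (\<Sum>k<n. ?V (Suc k) - ?V k + ?e k)"
      by (intro sum_mono step)
    also have "\<dots> = ?V n - ?V 0 + (\<Sum>k<n. ?e k)"
      unfolding sum.distrib by (simp only: sum_lessThan_telescope[of ?V])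
    also have "\<dots> \<le> 2 * B + E" using B[of n] B[of 0] E[of n] by linarith
    finally show "(\<Sum>k<n. r k * (norm (F (Z k \<omega>)))\<^sup>2) \<le> 2 * B + E" .
    show "0 \<le> r n * (norm (F (Z n \<omega>)))\<^sup>2" using r_range[of n] by simp
  qed
qed

section \<open>Almost sure convergence of the urns\<close>

text \<open>Serves two choices of weights: \<open>r n\<close> for the perturbation in the recursion
  and \<open>1 / (n + 1)\<close> for Kronecker's lemma. Unit vectors as transforms isolate the
  coordinates.\<close>

lemma AE_noise_summable:
  fixes a :: "nat \<Rightarrow> real"
  assumes a: "\<And>n. \<bar>a n\<bar> \<le> c / (real n + 1)"
  shows "AE \<omega> in M. \<forall>h. summable (\<lambda>n. a n * noise n \<omega> $ h)"
proof -
  have "AE \<omega> in M. summable (\<lambda>n. (a n *\<^sub>R axis h 1) \<bullet> noise n \<omega>)" for h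
  proof (rule noise_transform_summable)
    show "\<bar>(a n *\<^sub>R axis h 1 :: real^'n) $ k\<bar> \<le> c / (real n + 1)" for n k
      using a[of n] order_trans[OF abs_ge_zero a[of n]] by (simp add: axis_def)
  qed simp
  then have "AE \<omega> in M. \<forall>h\<in>UNIV. summable (\<lambda>n. a n * noise n \<omega> $ h)"
    by (intro AE_finite_allI) (auto simp: inner_axis')
  then show ?thesis by simp
qed

lemma Z_tendsto_zero:
  assumes fin: "finite (drift_zeros \<alpha> \<beta> q f :: (real^'n) set)" and \<omega>: "\<omega> \<in> space M"
    and noise: "\<And>h. summable (\<lambda>n. r n * noise n \<omega> $ h)"
    and drift: "summable (\<lambda>n. r n * (norm (F (Z n \<omega>)))\<^sup>2)"
  shows "\<exists>p \<in> drift_zeros \<alpha> \<beta> q f. (\<lambda>n. Z n \<omega>) \<longlonglongrightarrow> p"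
proof -
  have "dist (Z (Suc n) \<omega>) (Z n \<omega>) \<le> real CARD('n) * r n" for n
  proof -
    have "dist (Z (Suc n) \<omega>) (Z n \<omega>) \<le> (\<Sum>h\<in>UNIV. \<bar>Z (Suc n) \<omega> $ h - Z n \<omega> $ h\<bar>)"
      using norm_le_l1_cart[of "Z (Suc n) \<omega> - Z n \<omega>"] by (simp add: dist_norm)
    also have "\<dots> \<le> (\<Sum>h\<in>(UNIV::'n set). r n)" by (intro sum_mono Z_step_bound \<omega>)
    finally show ?thesis by simp
  qed
  then have step: "(\<lambda>n. dist (Z (Suc n) \<omega>) (Z n \<omega>)) \<longlonglongrightarrow> 0"
    by (intro real_tendsto_sandwich[OF always_eventually always_eventually tendsto_const
          tendsto_mult_right_zero[OF r_tendsto_0, of "real CARD('n)"]]) auto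
  \<comment> \<open>The coordinate series are reassembled into one series of vectors.\<close>
  have "summable (\<lambda>n. \<Sum>h\<in>UNIV. (r n * noise n \<omega> $ h) *\<^sub>R axis h (1::real))"
    by (intro summable_sum summable_scaleR_left noise)
  also have "(\<lambda>n. \<Sum>h\<in>UNIV. (r n * noise n \<omega> $ h) *\<^sub>R axis h (1::real)) = (\<lambda>n. r n *\<^sub>R noise n \<omega>)"
    by (simp add: fun_eq_iff vec_eq_iff axis_def if_distrib cong: if_cong)
  finally have sum: "summable (\<lambda>n. r n *\<^sub>R noise n \<omega>)" .
  have "(\<lambda>n. F (Z n \<omega>)) \<longlonglongrightarrow> 0"
    by (rule drift_vanishes[OF compact_cube continuous_on_drift Z_in_cube[OF \<omega>] Z_Suc[OF \<omega>]
          _ r_not_summable drift sum step]) (use r_range in auto)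
  from converges_to_zero_of_finite_zeros[OF compact_cube continuous_on_drift Z_in_cube[OF \<omega>] this step]
  show ?thesis using fin unfolding drift_zeros_eq by blast
qed

lemma averages_tendsto:
  assumes \<omega>: "\<omega> \<in> space M" and p: "p \<in> drift_zeros \<alpha> \<beta> q f" and lim: "(\<lambda>n. Z n \<omega>) \<longlonglongrightarrow> p"
    and noise: "\<And>h. summable (\<lambda>n. 1 / (real n + 1) * noise n \<omega> $ h)"
  shows "(\<lambda>n. (1 / real n) *\<^sub>R (\<Sum>k=1..n. I k \<omega>)) \<longlonglongrightarrow> p"
proof -
  have p': "p \<in> cube" "F p = 0" using p unfolding drift_zeros_eq by auto
  have "(\<lambda>n. F (Z n \<omega>)) \<longlonglongrightarrow> F p"
    using continuous_on_tendsto_compose[OF continuous_on_drift lim p'(1)] Z_in_cube[OF \<omega>] by simp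
  then have "(\<lambda>n. Z n \<omega> + F (Z n \<omega>)) \<longlonglongrightarrow> p" using tendsto_add[OF lim] p'(2) by fastforce
  from cesaro_means[OF this]
  have 1: "(\<lambda>n. (1 / real n) *\<^sub>R (\<Sum>k<n. Z k \<omega> + F (Z k \<omega>))) \<longlonglongrightarrow> p" .
  have 2: "(\<lambda>n. (1 / real n) *\<^sub>R (\<Sum>k<n. noise k \<omega>)) \<longlonglongrightarrow> 0"
  proof (rule vec_tendstoI)
    show "(\<lambda>n. ((1 / real n) *\<^sub>R (\<Sum>k<n. noise k \<omega>)) $ h) \<longlonglongrightarrow> 0 $ h" for h
      using kronecker_means[of "\<lambda>n. noise n \<omega> $ h"] noise[of h] by simp
  qed
  \<comment> \<open>Index shift: \<open>I (Suc k)\<close> is \<open>Z k + F (Z k) + noise k\<close>,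
    so the draws 1 to \<open>n\<close> match the indices below \<open>n\<close>.\<close>
  have "(\<Sum>k=1..n. I k \<omega>) = (\<Sum>k<n. Z k \<omega> + F (Z k \<omega>)) + (\<Sum>k<n. noise k \<omega>)" for n
    by (induction n) (simp_all add: noise_def)
  then show ?thesis using tendsto_add[OF 1 2] by (simp add: scaleR_add_right)
qed

text \<open>Three random series, for the potential, the recursion and the averages, converge outside
  a common null set; there the argument is deterministic.\<close>

lemma AE_convergence:
  assumes fin: "finite (drift_zeros \<alpha> \<beta> q f :: (real^'n) set)"
    and G: "\<And>x. x \<in> {0..1} \<Longrightarrow> (G has_real_derivative f x) (at x within {0..1})"
  shows "AE \<omega> in M. \<exists>p \<in> drift_zeros \<alpha> \<beta> q f. (\<lambda>n. Z n \<omega>) \<longlonglongrightarrow> p \<and>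
    (\<lambda>n. (1 / real n) *\<^sub>R (\<Sum>k=1..n. I k \<omega>)) \<longlonglongrightarrow> p"
proof -
  obtain c where c: "\<And>n. r n \<le> c / (real n + 1)" using r_bound by blast
  have "AE \<omega> in M. summable (\<lambda>n. (r n *\<^sub>R F (Z n \<omega>)) \<bullet> noise n \<omega>)"
  proof (rule noise_transform_summable)
    show "(\<lambda>\<omega>. (r n *\<^sub>R F (Z n \<omega>)) $ h) \<in> borel_measurable (hist_alg M Z I n)" for n h
      unfolding vector_scaleR_component
      by (intro borel_measurable_scaleR borel_measurable_const drift_hist_measurable) simp
    show "\<bar>(r n *\<^sub>R F (Z n \<omega>)) $ h\<bar> \<le> c / (real n + 1)" if "\<omega> \<in> space M" for n h \<omega>
    proof -
      have "r n * \<bar>F (Z n \<omega>) $ h\<bar> \<le> r n"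
        using r_range[of n] by (intro mult_left_le drift_range(2) Z_in_cube that) auto
      then show ?thesis using c[of n] r_range[of n] by (simp add: abs_mult)
    qed
  qed
  moreover have "AE \<omega> in M. \<forall>h. summable (\<lambda>n. r n * noise n \<omega> $ h)"
    by (rule AE_noise_summable[of _ c]) (use c r_range in auto)
  moreover have "AE \<omega> in M. \<forall>h. summable (\<lambda>n. 1 / (real n + 1) * noise n \<omega> $ h)"
    by (rule AE_noise_summable[of _ 1]) simp
  ultimately show ?thesis
    using AE_space
  proof eventually_elim
    case (elim \<omega>)
    have "summable (\<lambda>n. r n * (norm (F (Z n \<omega>)))\<^sup>2)"
      by (rule summable_weighted_drift[OF G elim(4,1)])
    then obtain p where "p \<in> drift_zeros \<alpha> \<beta> q f" "(\<lambda>n. Z n \<omega>) \<longlonglongrightarrow> p"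
      using Z_tendsto_zero[OF fin elim(4)] elim(2) by blast
    then show ?case using averages_tendsto[OF elim(4)] elim(3) by blast
  qed
qed

lemma Z_measurable: "Z n \<in> borel_measurable M"
proof (rule borel_measurable_euclidean_space[THEN iffD2, rule_format])
  fix i :: "real^'n" assume "i \<in> Basis"
  then obtain h where "i = axis h 1" unfolding Basis_vec_def Basis_real_def by blast
  then show "(\<lambda>\<omega>. Z n \<omega> \<bullet> i) \<in> borel_measurable M"
    using measurable_from_subalg[OF subalgebra_hist Z_hist_measurable[OF order_refl], of n h]
    by (simp add: inner_axis)
qed

text \<open>Pathwise limits become a random variable because \<open>lim\<close> of measurable
  functions is measurable and the finite zero set is closed, hence Borel.\<close>

lemma limit_exists:
  assumes fin: "finite (drift_zeros \<alpha> \<beta> q f :: (real^'n) set)"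
    and G: "\<And>x. x \<in> {0..1} \<Longrightarrow> (G has_real_derivative f x) (at x within {0..1})"
  shows "\<exists>Zinf :: 'a \<Rightarrow> real^'n. Zinf \<in> borel_measurable M \<and>
    (\<forall>\<omega>\<in>space M. Zinf \<omega> \<in> drift_zeros \<alpha> \<beta> q f) \<and>
    (AE \<omega> in M. (\<lambda>n. Z n \<omega>) \<longlonglongrightarrow> Zinf \<omega>) \<and>
    (AE \<omega> in M. (\<lambda>n. (1 / real n) *\<^sub>R (\<Sum>k=1..n. I k \<omega>)) \<longlonglongrightarrow> Zinf \<omega>)"
proof -
  let ?D = "drift_zeros \<alpha> \<beta> q f :: (real^'n) set"
  obtain p0 where p0: "p0 \<in> ?D" using diagonal_zero_exists by blast
  have AE: "AE \<omega> in M. \<exists>p\<in>?D. (\<lambda>n. Z n \<omega>) \<longlonglongrightarrow> p \<and>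
      (\<lambda>n. (1 / real n) *\<^sub>R (\<Sum>k=1..n. I k \<omega>)) \<longlonglongrightarrow> p"
    by (rule AE_convergence[OF fin G])
  define L where "L \<omega> = lim (\<lambda>n. Z n \<omega>)" for \<omega>
  \<comment> \<open>The diagonal zero \<open>p0\<close> is the default value on the exceptional set,
    so that \<open>Zinf\<close> lies in the zero set everywhere and not just almost surely.\<close>
  define Zinf where "Zinf \<omega> = (if L \<omega> \<in> ?D then L \<omega> else p0)" for \<omega>
  have L [measurable]: "L \<in> borel_measurable M"
    unfolding L_def by (rule borel_measurable_lim_metric[OF Z_measurable])
  have D [measurable]: "?D \<in> sets borel" using fin by (intro borel_closed finite_imp_closed)
  have "Zinf \<in> borel_measurable M" unfolding Zinf_def by measurable
  moreover have "\<forall>\<omega>\<in>space M. Zinf \<omega> \<in> ?D" using p0 by (simp add: Zinf_def)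
  moreover have "AE \<omega> in M. (\<lambda>n. Z n \<omega>) \<longlonglongrightarrow> Zinf \<omega> \<and>
      (\<lambda>n. (1 / real n) *\<^sub>R (\<Sum>k=1..n. I k \<omega>)) \<longlonglongrightarrow> Zinf \<omega>"
    using AE
  proof eventually_elim
    case (elim \<omega>)
    then obtain p where p: "p \<in> ?D" "(\<lambda>n. Z n \<omega>) \<longlonglongrightarrow> p"
      "(\<lambda>n. (1 / real n) *\<^sub>R (\<Sum>k=1..n. I k \<omega>)) \<longlonglongrightarrow> p" by blast
    then have "Zinf \<omega> = p" by (simp add: Zinf_def L_def limI)
    with p show ?case by simp
  qed
  ultimately show ?thesis by (auto simp: AE_conj_iff)
qed

end

theorem theorem2p1:
  fixes M :: "'a measure"
    and Z I :: "nat \<Rightarrow> 'a \<Rightarrow> real^'n"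
    and \<alpha> \<beta> q :: real
    and f :: "real \<Rightarrow> real"
    and r :: "nat \<Rightarrow> real"
  assumes prob: "prob_space M"
    and N: "CARD('n) \<ge> 2"
    and alpha: "\<alpha> \<in> {0..<1}" and beta: "\<beta> \<in> {0..<1}" and alpha_beta: "\<alpha> + \<beta> \<in> {0<..<1}"
    and q: "q \<in> {0<..1}"
    and f_range: "\<And>x. x \<in> {0..1} \<Longrightarrow> f x \<in> {0..1}"
    and f_mono: "strict_mono_on {0..1} f"
    and f_C1: "\<exists>f'. (\<forall>x\<in>{0..1}. (f has_real_derivative f' x) (at x within {0..1}))
              \<and> continuous_on {0..1} f'"
    and r_range: "\<And>n. r n \<in> {0..1}"
    and r_lim: "(\<lambda>n. real n * r n) \<longlonglongrightarrow> 1"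
    and Z0_meas: "\<And>h. (\<lambda>\<omega>. Z 0 \<omega> $ h) \<in> borel_measurable M"
    and Z0_range: "\<And>h \<omega>. \<omega> \<in> space M \<Longrightarrow> Z 0 \<omega> $ h \<in> {0..1}"
    and I_meas: "\<And>n h. (\<lambda>\<omega>. I (Suc n) \<omega> $ h) \<in> borel_measurable M"
    and I_range: "\<And>n h \<omega>. \<omega> \<in> space M \<Longrightarrow> I (Suc n) \<omega> $ h \<in> {0, 1}"
    and Z_step: "\<And>n h \<omega>. \<omega> \<in> space M \<Longrightarrow>
           Z (Suc n) \<omega> $ h = (1 - r n) * Z n \<omega> $ h + r n * I (Suc n) \<omega> $ h"
    and I_indep: "\<And>n. cond_indep_vars M (hist_alg M Z I n) (\<lambda>_. borel) (\<lambda>h \<omega>. I (Suc n) \<omega> $ h) UNIV"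
    and I_prob: "\<And>n h. AE \<omega> in M.
           cond_prob_alg M (hist_alg M Z I n) {\<omega> \<in> space M. I (Suc n) \<omega> $ h = 1} \<omega>
           = \<alpha> * vec_mean (Z n \<omega>) + \<beta> * q + (1 - \<alpha> - \<beta>) * f (Z n \<omega> $ h)"
  shows "(\<exists>z\<in>{0..1}. z *\<^sub>R 1 \<in> (drift_zeros \<alpha> \<beta> q f :: (real^'n) set)) \<and>
    (finite (drift_zeros \<alpha> \<beta> q f :: (real^'n) set) \<and>
     (\<exists>G. \<forall>x\<in>{0..1}. (G has_real_derivative f x) (at x within {0..1})) \<longrightarrow>
     (\<exists>Zinf :: 'a \<Rightarrow> real^'n.
        Zinf \<in> borel_measurable M \<and>
        (\<forall>\<omega>\<in>space M. Zinf \<omega> \<in> drift_zeros \<alpha> \<beta> q f) \<and>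
        (AE \<omega> in M. (\<lambda>n. Z n \<omega>) \<longlonglongrightarrow> Zinf \<omega>) \<and>
        (AE \<omega> in M. (\<lambda>n. (1 / real n) *\<^sub>R (\<Sum>k=1..n. I k \<omega>)) \<longlonglongrightarrow> Zinf \<omega>)))"
proof -
  obtain f' where f': "\<And>x. x \<in> {0..1} \<Longrightarrow> (f has_real_derivative f' x) (at x within {0..1})"
    using f_C1 by blast
  interpret prob_space M by (rule prob)
  interpret urn_system M Z I \<alpha> \<beta> q f r
  proof
    show "continuous_on {0..1} f" by (rule DERIV_continuous_on[OF f'])
    show "mono_on {0..1} f" by (rule strict_mono_on_imp_mono_on[OF f_mono])
    show "0 \<le> \<alpha>" "0 \<le> \<beta>" "\<alpha> + \<beta> \<le> 1" "q \<in> {0..1}" using alpha beta alpha_beta q by auto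
  qed (fact f_range r_range r_lim Z0_meas Z0_range I_meas I_range Z_step I_prob)+
  show ?thesis
  proof (intro conjI impI diagonal_zero_exists)
    assume *: "finite (drift_zeros \<alpha> \<beta> q f :: (real^'n) set) \<and>
      (\<exists>G. \<forall>x\<in>{0..1}. (G has_real_derivative f x) (at x within {0..1}))"
    then obtain G where "\<And>x. x \<in> {0..1} \<Longrightarrow> (G has_real_derivative f x) (at x within {0..1})"
      by blast
    then show "\<exists>Zinf :: 'a \<Rightarrow> real^'n. Zinf \<in> borel_measurable M \<and>
        (\<forall>\<omega>\<in>space M. Zinf \<omega> \<in> drift_zeros \<alpha> \<beta> q f) \<and>
        (AE \<omega> in M. (\<lambda>n. Z n \<omega>) \<longlonglongrightarrow> Zinf \<omega>) \<and>
        (AE \<omega> in M. (\<lambda>n. (1 / real n) *\<^sub>R (\<Sum>k=1..n. I k \<omega>)) \<longlonglongrightarrow> Zinf \<omega>)"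
      using limit_exists * by blast
  qed
qed

end
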